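(* Let $\varepsilon>0$. The geometric discretisation of the Suslov problem defined by the constraint subvariety $\mathcal{S}=\mathrm{Cay}_\varepsilon(\mathfrak{d})\subset SO(3)$ and the reduced discrete Lagrangian $\ell_d^{(1,\varepsilon)}(W)=-\frac1\varepsilon\mathrm{Trace}(\mathbb{J}W)$ is not consistent: there is no finite difference map $\Psi$ on $SO(3)$ with respect to which the pair $(D_d,L_d^{(\varepsilon)})$ determined by $(\mathcal{S},\ell_d^{(1,\varepsilon)})$ is consistent.
   Context: Suslov problem: $Q=SO(3)$ with identity $e$; $\mathbb{I}$ is a symmetric positive definite $3\times3$ matrix (inertia tensor) with entries $I_{ij}$, $I_{12}=0$, and $$\mathbb{J}=\begin{pmatrix}\frac12(I_{22}+I_{33}-I_{11})&0&-I_{13}\\0&\frac12(I_{11}+I_{33}-I_{22})&-I_{23}\\-I_{13}&-I_{23}&\frac12(I_{11}+I_{22}-I_{33})\end{pmatrix}.$$ $\mathbb{R}^3$ is identified with $\mathfrak{so}(3)$ by the hat map $\widehat\omega x=\omega\times x$. The Lagrangian is the left-invariant function $L:TSO(3)\to\mathbb{R}$ with $L(g,\dot g)=\ell(\omega)$, $\widehat\omega=g^{-1}\dot g$, $\ell(\omega)=\frac12\langle\mathbb{I}\omega,\omega\rangle=\frac12\mathrm{Trace}(\mathbb{J}\widehat\omega\widehat\omega^T)$. The constraint distribution is $\mathcal{D}_g=g\,\mathfrak{d}$, with $\mathfrak{d}=\{\omega\in\mathbb{R}^3:\omega_3=0\}$. The Cayley map is $\mathrm{Cay}_\varepsilon(\omega)=(e+\frac\varepsilon2\widehat\omega)(e-\frac\varepsilon2\widehat\omega)^{-1}$.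 A pair $(\mathcal{S},\ell_d^{(\varepsilon)})$ determines a discrete constraint space $D_d=\{(g,g')\in SO(3)\times SO(3):g^{-1}g'\in\mathcal{S}\}$ and a discrete Lagrangian $L_d^{(\varepsilon)}(g,g')=\ell_d^{(\varepsilon)}(g^{-1}g')$. A finite difference map on $Q$ is a diffeomorphism $\Psi:N_0(I_d)\to T_0Q$ from a neighbourhood $N_0(I_d)$ of the diagonal $I_d\subset Q\times Q$ onto a neighbourhood $T_0Q$ of the zero section of $TQ$ such that: (1) $\Psi(I_d)$ is the zero section; (2) $\tau_Q\circ\Psi(N_0(I_d))=Q$, where $\tau_Q:TQ\to Q$ is the bundle projection; (3) $\tau_Q\circ\Psi|_{I_d}=\pi_1|_{I_d}=\pi_2|_{I_d}$, where $\pi_1,\pi_2:Q\times Q\to Q$ are the projections. The discretisation $(D_d,L_d^{(\varepsilon)})$ is consistent with respect to $\Psi$ if $L_d^{(\varepsilon)}=\varepsilon L\circ\Psi$ and $\Psi(D_d)\subset\mathcal{D}$ (both understood on the domain of $\Psi$). *)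

theory Defs
  imports "HOL-Analysis.Analysis"
begin

section \<open>Smooth maps and diffeomorphisms between subsets of Euclidean spaces\<close>

text \<open>
  \<open>Ck_on k S f\<close> (for open \<open>S\<close>): \<open>f\<close> is \<open>k\<close> times continuously differentiable on \<open>S\<close>. The recursion
  goes through all directional derivatives, so that the codomain type stays fixed.
\<close>

primrec Ck_on :: "nat \<Rightarrow> 'a::euclidean_space set \<Rightarrow> ('a \<Rightarrow> 'b::euclidean_space) \<Rightarrow> bool" where
  "Ck_on 0 S f \<longleftrightarrow> continuous_on S f"
| "Ck_on (Suc k) S f \<longleftrightarrow>
     (\<forall>x\<in>S. f differentiable (at x)) \<and> (\<forall>v. Ck_on k S (\<lambda>x. frechet_derivative f (at x) v))"

definition smooth_on :: "'a::euclidean_space set \<Rightarrow> ('a \<Rightarrow> 'b::euclidean_space) \<Rightarrow> bool" where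
  "smooth_on S f \<longleftrightarrow> (\<forall>k. Ck_on k S f)"

text \<open>
  Smoothness on an arbitrary subset: local existence of smooth extensions to open sets. On (relatively
  open subsets of) embedded submanifolds this is smoothness in the sense of manifolds.
\<close>

definition smooth_map_on :: "'a::euclidean_space set \<Rightarrow> ('a \<Rightarrow> 'b::euclidean_space) \<Rightarrow> bool" where
  "smooth_map_on A f \<longleftrightarrow>
     (\<forall>x\<in>A. \<exists>U F. open U \<and> x \<in> U \<and> smooth_on U F \<and> (\<forall>y\<in>U \<inter> A. F y = f y))"

definition diffeomorphism_onto ::
    "'a::euclidean_space set \<Rightarrow> 'b::euclidean_space set \<Rightarrow> ('a \<Rightarrow> 'b) \<Rightarrow> bool" where
  "diffeomorphism_onto A B f \<longleftrightarrow>
     bij_betw f A B \<and> smooth_map_on A f \<and> smooth_map_on B (the_inv_into A f)"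


section \<open>The rotation group, its Lie algebra and its tangent bundle\<close>

type_synonym mat3 = "real^3^3"

definition SO3 :: "(mat3) set" where
  "SO3 = {g. rotation_matrix g}"

definition hat :: "real^3 \<Rightarrow> mat3" where
  "hat \<omega> = matrix (cross3 \<omega>)"

definition vee :: "mat3 \<Rightarrow> real^3" where
  "vee A = (THE \<omega>. hat \<omega> = A)"

text \<open>
  \<open>SO3\<close> is an embedded submanifold of the space of matrices; a tangent vector is represented by its
  base point together with a matrix, so that \<open>fst\<close> is the bundle projection. The tangent space at \<open>g\<close>
  is the left translate of the space of skew-symmetric matrices.
\<close>

definition TSO3 :: "(mat3 \<times> mat3) set" where
  "TSO3 = {(g, g ** hat \<omega>) | g \<omega>. g \<in> SO3}"

definition zero_section :: "(mat3 \<times> mat3) set" where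
  "zero_section = {(g, 0) | g. g \<in> SO3}"

definition diagonal :: "(mat3 \<times> mat3) set" where
  "diagonal = {(g, g) | g. g \<in> SO3}"

lemma hat_entries:
  "hat \<omega> $ 1 $ 1 = 0"          "hat \<omega> $ 1 $ 2 = - (\<omega> $ 3)"  "hat \<omega> $ 1 $ 3 = \<omega> $ 2"
  "hat \<omega> $ 2 $ 1 = \<omega> $ 3"      "hat \<omega> $ 2 $ 2 = 0"          "hat \<omega> $ 2 $ 3 = - (\<omega> $ 1)"
  "hat \<omega> $ 3 $ 1 = - (\<omega> $ 2)"  "hat \<omega> $ 3 $ 2 = \<omega> $ 1"      "hat \<omega> $ 3 $ 3 = 0"
  by (simp_all add: hat_def matrix_def cross3_def axis_def)

lemma vee_hat [simp]: "vee (hat \<omega>) = \<omega>"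
  unfolding vee_def
proof (rule the_equality)
  show "x = \<omega>" if "hat x = hat \<omega>" for x
    using hat_entries[of x] hat_entries[of \<omega>] that by (simp add: vec_eq_iff forall_3)
qed simp

lemma hat_mult_vec: "hat \<omega> *v x = cross3 \<omega> x"
  by (simp add: vec_eq_iff forall_3 matrix_vector_mult_def sum_3 hat_entries cross3_def)

lemma matrix_inv_mult:
  fixes A :: "real^'n^'n"
  assumes "det A \<noteq> 0"
  shows "A ** matrix_inv A = mat 1" "matrix_inv A ** A = mat 1"
proof -
  have "\<exists>B. A ** B = mat 1 \<and> B ** A = mat 1"
    using assms by (simp add: invertible_det_nz[symmetric] invertible_def)
  hence "A ** matrix_inv A = mat 1 \<and> matrix_inv A ** A = mat 1"
    unfolding matrix_inv_def by (rule someI_ex)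
  thus "A ** matrix_inv A = mat 1" "matrix_inv A ** A = mat 1"
    by auto
qed

lemma SO3_inv_mult_cancel: "g \<in> SO3 \<Longrightarrow> matrix_inv g ** (g ** A) = A"
  by (simp add: SO3_def rotation_matrix_def matrix_mul_assoc matrix_inv_mult)

lemma TSO3_iff:
  "(g, v) \<in> TSO3 \<longleftrightarrow> g \<in> SO3 \<and> transpose (matrix_inv g ** v) = - (matrix_inv g ** v)"
proof -
  have 1: "transpose (hat \<omega>) = - hat \<omega>" for \<omega>
    by (simp add: vec_eq_iff forall_3 transpose_def hat_entries)
  have 2: "\<exists>\<omega>. A = hat \<omega>" if A: "transpose A = - A" for A :: mat3
  proof -
    have A': "A $ i $ j = - A $ j $ i" for i j
      using arg_cong[OF A, of "\<lambda>B. B $ j $ i"] by (simp add: transpose_def)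
    have "A $ 1 $ 1 = 0" "A $ 2 $ 2 = 0" "A $ 3 $ 3 = 0"
      using A'[of 1 1] A'[of 2 2] A'[of 3 3] by linarith+
    hence "A = hat (vector [A $ 3 $ 2, A $ 1 $ 3, A $ 2 $ 1])"
      using A'[of 1 2] A'[of 2 3] A'[of 3 1]
      unfolding vec_eq_iff forall_3 hat_entries by simp
    thus ?thesis ..
  qed
  have 3: "g ** (matrix_inv g ** v) = v" if "g \<in> SO3"
    using that by (simp add: SO3_def rotation_matrix_def matrix_mul_assoc matrix_inv_mult)
  show ?thesis
  proof
    assume "(g, v) \<in> TSO3"
    then show "g \<in> SO3 \<and> transpose (matrix_inv g ** v) = - (matrix_inv g ** v)"
      by (auto simp: TSO3_def SO3_inv_mult_cancel 1)
  next
    assume *: "g \<in> SO3 \<and> transpose (matrix_inv g ** v) = - (matrix_inv g ** v)"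
    then obtain \<omega> where "matrix_inv g ** v = hat \<omega>"
      using 2 by blast
    hence "v = g ** hat \<omega>"
      using * 3 by metis
    thus "(g, v) \<in> TSO3"
      using * by (auto simp: TSO3_def)
  qed
qed


section \<open>Finite difference maps and consistency\<close>

text \<open>
  Neighbourhoods are (relatively) open sets. \<open>\<Psi>\<close> is a total function with domain \<open>N\<close> and range \<open>T\<close>;
  its values outside \<open>N\<close> are irrelevant.
\<close>

definition finite_difference_map ::
    "(mat3 \<times> mat3) set \<Rightarrow> (mat3 \<times> mat3) set \<Rightarrow>
     (mat3 \<times> mat3 \<Rightarrow> mat3 \<times> mat3) \<Rightarrow> bool" where
  "finite_difference_map N T \<Psi> \<longleftrightarrow>
     openin (top_of_set (SO3 \<times> SO3)) N \<and> diagonal \<subseteq> N \<and>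
     openin (top_of_set TSO3) T \<and> zero_section \<subseteq> T \<and>
     diffeomorphism_onto N T \<Psi> \<and>
     \<Psi> ` diagonal = zero_section \<and>
     (fst \<circ> \<Psi>) ` N = SO3 \<and>
     (\<forall>p\<in>diagonal. fst (\<Psi> p) = fst p \<and> fst (\<Psi> p) = snd p)"

text \<open>
  Consistency, with respect to a map \<open>\<Psi>\<close> with domain \<open>N\<close>, of the discretisation \<open>(Dd, Ld)\<close> of the
  system with constraint distribution \<open>D\<close> and Lagrangian \<open>L\<close>.
\<close>

definition consistent_wrt ::
    "(mat3 \<times> mat3) set \<Rightarrow> (mat3 \<times> mat3 \<Rightarrow> mat3 \<times> mat3) \<Rightarrow> real \<Rightarrow>
     (mat3 \<times> mat3) set \<Rightarrow> (mat3 \<times> mat3 \<Rightarrow> real) \<Rightarrow>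
     (mat3 \<times> mat3) set \<Rightarrow> (mat3 \<times> mat3 \<Rightarrow> real) \<Rightarrow> bool" where
  "consistent_wrt N \<Psi> \<epsilon> D L Dd Ld \<longleftrightarrow>
     (\<forall>p\<in>N. Ld p = \<epsilon> * L (\<Psi> p)) \<and> \<Psi> ` (Dd \<inter> N) \<subseteq> D"

definition discrete_constraint :: "(mat3) set \<Rightarrow> (mat3 \<times> mat3) set" where
  "discrete_constraint S = {(g, g'). g \<in> SO3 \<and> g' \<in> SO3 \<and> matrix_inv g ** g' \<in> S}"

definition discrete_Lagrangian :: "(mat3 \<Rightarrow> real) \<Rightarrow> mat3 \<times> mat3 \<Rightarrow> real" where
  "discrete_Lagrangian l = (\<lambda>(g, g'). l (matrix_inv g ** g'))"


section \<open>The Suslov problem and its discretisation\<close>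

definition inertia_tensor :: "mat3 \<Rightarrow> bool" where
  "inertia_tensor I \<longleftrightarrow>
     transpose I = I \<and> (\<forall>x. x \<noteq> 0 \<longrightarrow> (I *v x) \<bullet> x > 0) \<and> I $ 1 $ 2 = 0"

definition mass_matrix :: "mat3 \<Rightarrow> mat3" where
  "mass_matrix I = vector
     [vector [(I$2$2 + I$3$3 - I$1$1) / 2, 0, - (I$1$3)],
      vector [0, (I$1$1 + I$3$3 - I$2$2) / 2, - (I$2$3)],
      vector [- (I$1$3), - (I$2$3), (I$1$1 + I$2$2 - I$3$3) / 2]]"

definition reduced_Lagrangian :: "mat3 \<Rightarrow> real^3 \<Rightarrow> real" where
  "reduced_Lagrangian I \<omega> = (I *v \<omega>) \<bullet> \<omega> / 2"

definition Suslov_Lagrangian :: "mat3 \<Rightarrow> mat3 \<times> mat3 \<Rightarrow> real" where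
  "Suslov_Lagrangian I = (\<lambda>(g, v). reduced_Lagrangian I (vee (matrix_inv g ** v)))"

definition constraint_space :: "(real^3) set" where
  "constraint_space = {\<omega>. \<omega> $ 3 = 0}"

definition Suslov_distribution :: "(mat3 \<times> mat3) set" where
  "Suslov_distribution = {(g, g ** hat \<omega>) | g \<omega>. g \<in> SO3 \<and> \<omega> \<in> constraint_space}"

definition Cayley :: "real \<Rightarrow> real^3 \<Rightarrow> mat3" where
  "Cayley \<epsilon> \<omega> = (mat 1 + (\<epsilon>/2) *\<^sub>R hat \<omega>) ** matrix_inv (mat 1 - (\<epsilon>/2) *\<^sub>R hat \<omega>)"

definition discrete_reduced_Lagrangian :: "mat3 \<Rightarrow> real \<Rightarrow> mat3 \<Rightarrow> real" where
  "discrete_reduced_Lagrangian I \<epsilon> W = - (1 / \<epsilon>) * trace (mass_matrix I ** W)"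

lemma reduced_Lagrangian_eq_trace:
  assumes "inertia_tensor I"
  shows "reduced_Lagrangian I \<omega> =
    trace (mass_matrix I ** hat \<omega> ** transpose (hat \<omega>)) / 2"
proof -
  have I: "transpose I = I" and I12: "I$1$2 = 0"
    using assms by (simp_all add: inertia_tensor_def)
  have I': "I$j$i = I$i$j" for i j
    using arg_cong[OF I, of "\<lambda>B. B $ i $ j"] by (simp add: transpose_def)
  have sym: "I$2$1 = 0" "I$1$2 = 0" "I$3$1 = I$1$3" "I$3$2 = I$2$3"
    using I12 I'[of 1 2] I'[of 1 3] I'[of 2 3] by simp_all
  show ?thesis
    unfolding reduced_Lagrangian_def mass_matrix_def trace_def matrix_matrix_mult_def
      transpose_def sum_3 matrix_vector_mult_def inner_vec_def vec_lambda_beta vector_3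
      hat_entries sym inner_real_def
    by (simp add: field_simps)
qed

lemma Suslov_Lagrangian_left_trivialised:
  "g \<in> SO3 \<Longrightarrow> Suslov_Lagrangian I (g, g ** hat \<omega>) = reduced_Lagrangian I \<omega>"
  by (simp add: Suslov_Lagrangian_def SO3_inv_mult_cancel)

lemma Cayley_in_SO3: "Cayley \<epsilon> \<omega> \<in> SO3"
proof -
  define A where "A = (\<epsilon>/2) *\<^sub>R hat \<omega>"
  define B where "B = matrix_inv (mat 1 - A)"
  have tA: "transpose A = - A"
    by (simp add: A_def vec_eq_iff forall_3 transpose_def hat_entries)
  have detm: "det (mat 1 - A) = 1 + (\<epsilon>/2)\<^sup>2 * ((\<omega>$1)\<^sup>2 + (\<omega>$2)\<^sup>2 + (\<omega>$3)\<^sup>2)"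
    and detp: "det (mat 1 + A) = 1 + (\<epsilon>/2)\<^sup>2 * ((\<omega>$1)\<^sup>2 + (\<omega>$2)\<^sup>2 + (\<omega>$3)\<^sup>2)"
    by (simp_all add: A_def det_3 mat_def hat_entries power2_eq_square algebra_simps)
  have pos: "det (mat 1 - A) > 0"
    unfolding detm by (smt (verit) mult_nonneg_nonneg zero_le_power2)
  have BR: "(mat 1 - A) ** B = mat 1"
    using pos unfolding B_def by (simp add: matrix_inv_mult)
  have transpose_add: "transpose (X + Y) = transpose X + transpose Y"
    and transpose_diff: "transpose (X - Y) = transpose X - transpose Y" for X Y :: mat3
    by (simp_all add: vec_eq_iff transpose_def)
  have tm: "transpose (mat 1 - A) = mat 1 + A" and tp: "transpose (mat 1 + A) = mat 1 - A"
    by (simp_all add: transpose_add transpose_diff tA transpose_mat)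
  have matrix_mult_diff: "(X - Y) ** Z = X ** Z - Y ** Z" "Z ** (X - Y) = Z ** X - Z ** Y"
      "(X + Y) ** Z = X ** Z + Y ** Z" for X Y Z :: mat3
    by (simp_all add: vec_eq_iff matrix_matrix_mult_def sum_subtractf sum.distrib ring_distribs)
  have comm: "(mat 1 - A) ** (mat 1 + A) = (mat 1 + A) ** (mat 1 - A)"
    by (simp add: matrix_add_ldistrib matrix_mult_diff)
  have tB: "transpose B ** (mat 1 + A) = mat 1"
    using arg_cong[OF BR, of transpose]
    by (simp add: matrix_transpose_mul tm transpose_mat)
  have "transpose ((mat 1 + A) ** B) ** ((mat 1 + A) ** B)
      = transpose B ** ((mat 1 - A) ** (mat 1 + A)) ** B"
    by (simp add: matrix_transpose_mul tp matrix_mul_assoc)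
  also have "\<dots> = (transpose B ** (mat 1 + A)) ** ((mat 1 - A) ** B)"
    unfolding comm by (simp add: matrix_mul_assoc)
  also have "\<dots> = mat 1"
    by (simp add: tB BR)
  finally have orth: "orthogonal_matrix ((mat 1 + A) ** B)"
    by (simp add: orthogonal_matrix)
  have "det ((mat 1 + A) ** B) = det ((mat 1 - A) ** B)"
    by (simp add: det_mul detp detm)
  hence "det ((mat 1 + A) ** B) = 1"
    by (simp add: BR)
  with orth show ?thesis
    by (simp add: Cayley_def SO3_def rotation_matrix_def A_def B_def)
qed

end

theory Submission
  imports Defs
begin

text \<open>
  A finite difference map sends the diagonal to the zero section, where the Lagrangian vanishes, so
  consistency would force \<open>L\<^sub>d\<close> to vanish on the diagonal. Its value there is
  \<open>-Trace(J)/\<epsilon> = -Trace(I)/(2\<epsilon>) < 0\<close>.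
\<close>

text \<open>Positive definiteness tested on the basis vector \<open>axis i 1\<close>.\<close>

lemma inertia_tensor_diag_pos:
  assumes "inertia_tensor I"
  shows "I $ i $ i > 0"
proof -
  have "(I *v axis i 1) \<bullet> axis i 1 > 0"
    using assms by (simp add: inertia_tensor_def axis_eq_0_iff)
  then show ?thesis
    by (simp add: inner_axis matrix_vector_mul_component)
qed

text \<open>Each \<open>I $ i $ i\<close> enters two diagonal entries with coefficient 1/2 and one
  with -1/2.\<close>

lemma trace_mass_matrix: "trace (mass_matrix I) = trace I / 2"
  by (simp add: trace_def sum_3 mass_matrix_def field_simps)

lemma mat_1_in_SO3: "mat 1 \<in> SO3"
  by (simp add: SO3_def rotation_matrix_def orthogonal_matrix_id)

lemma discrete_Lagrangian_diagonal:
  assumes "g \<in> SO3"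
  shows "discrete_Lagrangian (discrete_reduced_Lagrangian I \<epsilon>) (g, g) = - trace I / (2 * \<epsilon>)"
  \<comment> \<open>Cancelling in front of \<open>mat 1\<close> gives
    \<open>matrix_inv g ** g = mat 1\<close>, so the reduced Lagrangian is evaluated at the
    identity.\<close>
  using SO3_inv_mult_cancel[OF assms, of "mat 1"]
  by (simp add: discrete_Lagrangian_def discrete_reduced_Lagrangian_def trace_mass_matrix)

lemma Suslov_Lagrangian_zero:
  assumes "g \<in> SO3"
  shows "Suslov_Lagrangian I (g, 0) = 0"
proof -
  \<comment> \<open>This writes the zero vector at \<open>g\<close> as \<open>g ** hat 0\<close>,
    the form to which left trivialisation applies.\<close>
  have "hat 0 = 0"
    by (simp add: vec_eq_iff forall_3 hat_entries)
  then show ?thesis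
    using Suslov_Lagrangian_left_trivialised[OF assms, of I 0]
    by (simp add: reduced_Lagrangian_def)
qed

theorem proposition4p1:
  fixes I :: "real^3^3" and \<epsilon> :: real
  assumes "inertia_tensor I"
    and "\<epsilon> > 0"
  shows "\<not> (\<exists>N T \<Psi>. finite_difference_map N T \<Psi> \<and>
    consistent_wrt N \<Psi> \<epsilon> Suslov_distribution (Suslov_Lagrangian I)
      (discrete_constraint (Cayley \<epsilon> ` constraint_space))
      (discrete_Lagrangian (discrete_reduced_Lagrangian I \<epsilon>)))"
proof clarify
  fix N T \<Psi>
  assume fd: "finite_difference_map N T \<Psi>"
    and cons: "consistent_wrt N \<Psi> \<epsilon> Suslov_distribution (Suslov_Lagrangian I)
      (discrete_constraint (Cayley \<epsilon> ` constraint_space))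
      (discrete_Lagrangian (discrete_reduced_Lagrangian I \<epsilon>))"
  let ?e = "mat 1 :: mat3"
  have diag: "(?e, ?e) \<in> diagonal"
    by (simp add: diagonal_def mat_1_in_SO3)
  with fd have N: "(?e, ?e) \<in> N" and "\<Psi> (?e, ?e) \<in> zero_section"
    unfolding finite_difference_map_def by blast+
  then obtain g where "g \<in> SO3" "\<Psi> (?e, ?e) = (g, 0)"
    by (auto simp: zero_section_def)
  then have "Suslov_Lagrangian I (\<Psi> (?e, ?e)) = 0"
    by (simp add: Suslov_Lagrangian_zero)
  \<comment> \<open>The contradiction comes from the Lagrangian half of consistency, at the single
    point \<open>(?e, ?e)\<close>.\<close>
  with cons N have "discrete_Lagrangian (discrete_reduced_Lagrangian I \<epsilon>) (?e, ?e) = 0"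
    by (simp add: consistent_wrt_def)
  then have "trace I = 0"
    using assms(2) by (simp add: discrete_Lagrangian_diagonal mat_1_in_SO3)
  moreover have "trace I > 0"
    unfolding trace_def by (intro sum_pos inertia_tensor_diag_pos[OF assms(1)]) auto
  ultimately show False
    by simp
qed

end
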